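(* For any $T>0$, the Hadamard fractional Brownian motion $B^{\mathcal H}_\alpha$ is a $(1,\alpha,T)$-generalized quasi-helix if $\alpha\in(0,1)$, and an $(\alpha,1,T)$-generalized quasi-helix if $\alpha\in(1,2)$.
   Context: Let $B=\{B(t)\}_{t\ge0}$ be a standard Brownian motion. For $\alpha>0$ the Hadamard fractional Brownian motion is the centered Gaussian process $B^{\mathcal H}_\alpha=\{B^{\mathcal H}_\alpha(t)\}_{t\ge 0}$ given by $B^{\mathcal H}_\alpha(0)=0$ and the Wiener integral $$B^{\mathcal H}_\alpha(t)=\frac1{\sqrt{\Gamma(\alpha)}}\int_0^t\Big(\log\frac ts\Big)^{(\alpha-1)/2}dB(s),\qquad t>0.$$ A stochastic process $X=\{X_t,\ t\in[0,T]\}$ is called a $(\gamma_1,\gamma_2,T)$-generalized quasi-helix (with $\gamma_1,\gamma_2>0$) if there exist two constants $C_1,C_2>0$ such that for all $s,t\in[0,T]$ $$C_1|t-s|^{\gamma_1}\le\mathbb E|X_t-X_s|^2\le C_2|t-s|^{\gamma_2}.$$ *)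

theory Defs
  imports "HOL-Probability.Probability"
begin

text \<open>Processes indexed by \<open>[0, \<infinity>)\<close> are functions on all of \<^typ>\<open>real\<close>; values at negative
  times are never constrained or used. The second parameter of \<^const>\<open>normal_density\<close> is the
  standard deviation, so increments over \<open>[s, t]\<close> have variance \<open>t - s\<close>.\<close>

locale standard_brownian_motion = prob_space M
  for M :: "'a measure" and B :: "real \<Rightarrow> 'a \<Rightarrow> real" +
  assumes random_variable_B: "t \<ge> 0 \<Longrightarrow> random_variable borel (B t)"
    and start_zero: "AE \<omega> in M. B 0 \<omega> = 0"
    and indep_increments: "0 \<le> p 0 \<Longrightarrow> mono (p :: nat \<Rightarrow> real) \<Longrightarrow>
      indep_vars (\<lambda>_. borel) (\<lambda>i \<omega>. B (p (Suc i)) \<omega> - B (p i) \<omega>) {..<n :: nat}"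
    and normal_increments: "0 \<le> s \<Longrightarrow> s < t \<Longrightarrow>
      distributed M lborel (\<lambda>\<omega>. B t \<omega> - B s \<omega>) (normal_density 0 (sqrt (t - s)))"
    and continuous_paths: "AE \<omega> in M. continuous_on {0..} (\<lambda>t. B t \<omega>)"

text \<open>A list of triples \<open>(c, a, b)\<close> represents the step function
  \<open>\<Sum> c \<cdot> 1\<^bsub>(a, b]\<^esub>\<close>; the intervals may overlap.\<close>

definition step_fun :: "(real \<times> real \<times> real) list \<Rightarrow> real \<Rightarrow> real" where
  "step_fun xs s = (\<Sum>(c, a, b)\<leftarrow>xs. c * indicator {a<..b} s)"

definition step_integral ::
  "(real \<Rightarrow> 'a \<Rightarrow> real) \<Rightarrow> (real \<times> real \<times> real) list \<Rightarrow> 'a \<Rightarrow> real" where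
  "step_integral B xs \<omega> = (\<Sum>(c, a, b)\<leftarrow>xs. c * (B b \<omega> - B a \<omega>))"

text \<open>\<open>has_wiener_integral M B t f I\<close>: the random variable \<open>I\<close> is (a version of) the Wiener
  integral of \<open>f\<close> over \<open>[0, t]\<close> with respect to \<open>B\<close>, that is, the limit in \<open>L\<^sup>2(M)\<close> of the
  integrals of step functions converging to \<open>f\<close> in \<open>L\<^sup>2[0, t]\<close>. By the isometry property, \<open>I\<close> is unique
  up to almost sure equality and does not depend on the approximating sequence.\<close>

definition has_wiener_integral ::
  "'a measure \<Rightarrow> (real \<Rightarrow> 'a \<Rightarrow> real) \<Rightarrow> real \<Rightarrow> (real \<Rightarrow> real) \<Rightarrow> ('a \<Rightarrow> real) \<Rightarrow> bool" where
  "has_wiener_integral M B t f I \<longleftrightarrow>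
     set_borel_measurable lborel {0..t} f \<and> I \<in> borel_measurable M \<and>
     (\<exists>\<xi>. (\<forall>n. \<forall>(c, a, b)\<in>set (\<xi> n). 0 \<le> a \<and> a \<le> b \<and> b \<le> t) \<and>
          ((\<lambda>n. \<integral>\<^sup>+s\<in>{0..t}. ennreal ((step_fun (\<xi> n) s - f s)\<^sup>2) \<partial>lborel) \<longlonglongrightarrow> 0) \<and>
          ((\<lambda>n. \<integral>\<^sup>+\<omega>. ennreal ((step_integral B (\<xi> n) \<omega> - I \<omega>)\<^sup>2) \<partial>M) \<longlonglongrightarrow> 0))"

text \<open>Each \<open>X t\<close> may be any version of the Wiener integral. The values of the kernel at the endpoints
  \<open>s = 0\<close> and \<open>s = t\<close> are irrelevant.\<close>

definition hadamard_fbm ::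
  "'a measure \<Rightarrow> (real \<Rightarrow> 'a \<Rightarrow> real) \<Rightarrow> real \<Rightarrow> (real \<Rightarrow> 'a \<Rightarrow> real) \<Rightarrow> bool" where
  "hadamard_fbm M B \<alpha> X \<longleftrightarrow>
     (\<forall>\<omega>\<in>space M. X 0 \<omega> = 0) \<and>
     (\<forall>t>0. \<exists>I. has_wiener_integral M B t (\<lambda>s. ln (t / s) powr ((\<alpha> - 1) / 2)) I \<and>
        (\<forall>\<omega>\<in>space M. X t \<omega> = 1 / sqrt (Gamma \<alpha>) * I \<omega>))"

text \<open>The integrability clause is needed because the Bochner integral of a non-integrable function
  is \<open>0\<close>; on paper it is implicit in the upper bound.\<close>

definition generalized_quasi_helix ::
  "'a measure \<Rightarrow> (real \<Rightarrow> 'a \<Rightarrow> real) \<Rightarrow> real \<Rightarrow> real \<Rightarrow> real \<Rightarrow> bool" where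
  "generalized_quasi_helix M X \<gamma>1 \<gamma>2 T \<longleftrightarrow>
     prob_space M \<and> \<gamma>1 > 0 \<and> \<gamma>2 > 0 \<and> (\<forall>t\<in>{0..T}. X t \<in> borel_measurable M) \<and>
     (\<exists>C1>0. \<exists>C2>0. \<forall>s\<in>{0..T}. \<forall>t\<in>{0..T}.
        integrable M (\<lambda>\<omega>. \<bar>X t \<omega> - X s \<omega>\<bar>\<^sup>2) \<and>
        C1 * \<bar>t - s\<bar> powr \<gamma>1 \<le> (\<integral>\<omega>. \<bar>X t \<omega> - X s \<omega>\<bar>\<^sup>2 \<partial>M) \<and>
        (\<integral>\<omega>. \<bar>X t \<omega> - X s \<omega>\<bar>\<^sup>2 \<partial>M) \<le> C2 * \<bar>t - s\<bar> powr \<gamma>2)"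

end

theory Submission
  imports Defs
begin

text \<open>
  Write \<open>K\<^sub>t(u) = (ln (t / u))\<^bsup>(\<alpha> - 1) / 2\<^esup>\<close> for \<open>0 < u < t\<close> and \<open>K\<^sub>t(u) = 0\<close> elsewhere. The Wiener
  isometry turns the claim into one about a deterministic integral,
  \<open>E \<bar>X\<^sub>t - X\<^sub>s\<bar>\<^sup>2 = D(s, t) / \<Gamma>(\<alpha>)\<close> with \<open>D(s, t) = \<integral> (K\<^sub>t - K\<^sub>s)\<^sup>2\<close>
  (lemma \<open>has_bochner_integral_hadamard_increment\<close>), and \<open>D\<close> is estimated by hand for \<open>s < t\<close>.

  The isometry rests on the identity \<open>E (B\<^sub>t - B\<^sub>s)\<^sup>2 = \<bar>t - s\<bar>\<close>. By polarisation it
  determines every mixed second moment of increments, hence the second moment of every step integral.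
  The functions \<open>1\<^bsub>(0, t]\<^esub>\<close> have increments with the same squared norms in \<open>L\<^sup>2\<close> of Lebesgue
  measure, and their step integrals are the step functions themselves, so the two norms agree. An
  \<open>L\<^sup>2\<close> limit extends the equality to all Wiener integrals.

  For the upper bounds, the substitution \<open>u = t v\<close> gives \<open>\<integral> K\<^sub>t\<^sup>2 = c t\<close> with a constant \<open>c\<close>, which is
  finite because a function with a Wiener integral is square integrable. If \<open>\<alpha> \<ge> 1\<close>, then
  \<open>0 \<le> K\<^sub>s \<le> K\<^sub>t\<close>, so \<open>(K\<^sub>t - K\<^sub>s)\<^sup>2 \<le> K\<^sub>t\<^sup>2 - K\<^sub>s\<^sup>2\<close> and \<open>D(s, t) \<le> c (t - s)\<close>. If \<open>\<alpha> \<le> 1\<close>, the order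
  is reversed on \<open>(0, s)\<close>, so \<open>(K\<^sub>t - K\<^sub>s)\<^sup>2 \<le> K\<^sub>s\<^sup>2 - K\<^sub>t\<^sup>2 + 2 \<cdot> 1\<^bsub>[s, t)\<^esub> K\<^sub>t\<^sup>2\<close>. The first two terms
  integrate to \<open>c (s - t) \<le> 0\<close>, and \<open>ln (t / u) \<ge> (t - u) / t\<close> bounds the last one by a multiple of
  \<open>t\<^bsup>1 - \<alpha>\<^esup> (t - s)\<^sup>\<alpha>\<close>.

  For the lower bounds, \<open>K\<^sub>s\<close> vanishes on \<open>(s, t)\<close>, so it suffices to bound \<open>K\<^sub>t\<^sup>2\<close> from below on one
  half of this interval. If \<open>\<alpha> \<le> 1\<close>, then \<open>K\<^sub>t \<ge> 1\<close> on the upper half, where \<open>ln (t / u) \<le> 1\<close>. If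
  \<open>\<alpha> \<ge> 1\<close>, then \<open>ln (t / u) \<ge> (t - s) / (2 t)\<close> on the lower half. The powers of \<open>t\<close> that remain in
  these estimates are compared with the same powers of \<open>T\<close>.
\<close>

section \<open>The Wiener isometry on step functions\<close>

text \<open>The value \<open>\<bar>b - p\<bar> + \<bar>a - q\<bar> - \<bar>b - q\<bar> - \<bar>a - p\<bar>\<close> is twice the length of
  \<open>(a, b] \<inter> (p, q]\<close>, so this is the bilinear form \<open>\<integral> step_fun xs \<cdot> step_fun ys\<close>. It is written with
  distances because polarisation produces exactly these four terms.\<close>

definition increment_form ::
  "(real \<times> real \<times> real) list \<Rightarrow> (real \<times> real \<times> real) list \<Rightarrow> real" where
  "increment_form xs ys = (\<Sum>(c, a, b)\<leftarrow>xs. \<Sum>(d, p, q)\<leftarrow>ys.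
     c * d * ((\<bar>b - p\<bar> + \<bar>a - q\<bar> - \<bar>b - q\<bar> - \<bar>a - p\<bar>) / 2))"

text \<open>Polarisation:
  \<open>2 (y\<^sub>b - y\<^sub>a) (y\<^sub>q - y\<^sub>p) = (y\<^sub>b - y\<^sub>p)\<^sup>2 + (y\<^sub>a - y\<^sub>q)\<^sup>2 - (y\<^sub>b - y\<^sub>q)\<^sup>2 - (y\<^sub>a - y\<^sub>p)\<^sup>2\<close>. The process \<open>Y\<close> and
  the measure \<open>N\<close> are arbitrary because the lemma serves both sides of the isometry.\<close>

lemma has_bochner_integral_increment_product:
  fixes Y :: "real \<Rightarrow> 'b \<Rightarrow> real"
  assumes Y: "\<And>s t. 0 \<le> s \<Longrightarrow> 0 \<le> t \<Longrightarrow>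
      has_bochner_integral N (\<lambda>\<omega>. (Y t \<omega> - Y s \<omega>)\<^sup>2) \<bar>t - s\<bar>"
    and nonneg: "0 \<le> a" "0 \<le> b" "0 \<le> p" "0 \<le> q"
  shows "has_bochner_integral N (\<lambda>\<omega>. (Y b \<omega> - Y a \<omega>) * (Y q \<omega> - Y p \<omega>))
           ((\<bar>b - p\<bar> + \<bar>a - q\<bar> - \<bar>b - q\<bar> - \<bar>a - p\<bar>) / 2)"
proof -
  have "has_bochner_integral N
      (\<lambda>\<omega>. ((Y b \<omega> - Y p \<omega>)\<^sup>2 + (Y a \<omega> - Y q \<omega>)\<^sup>2 - (Y b \<omega> - Y q \<omega>)\<^sup>2 - (Y a \<omega> - Y p \<omega>)\<^sup>2) / 2)
      ((\<bar>b - p\<bar> + \<bar>a - q\<bar> - \<bar>b - q\<bar> - \<bar>a - p\<bar>) / 2)"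
    by (intro has_bochner_integral_divide has_bochner_integral_diff has_bochner_integral_add Y nonneg)
  then show ?thesis
    by (rule has_bochner_integral_cong[THEN iffD1, rotated -1])
       (auto simp: power2_eq_square field_simps)
qed

lemma has_bochner_integral_step_integral_product:
  fixes Y :: "real \<Rightarrow> 'b \<Rightarrow> real"
  assumes Y: "\<And>s t. 0 \<le> s \<Longrightarrow> 0 \<le> t \<Longrightarrow>
      has_bochner_integral N (\<lambda>\<omega>. (Y t \<omega> - Y s \<omega>)\<^sup>2) \<bar>t - s\<bar>"
    and xs: "\<forall>(c, a, b)\<in>set xs. 0 \<le> a \<and> a \<le> b"
    and ys: "\<forall>(c, a, b)\<in>set ys. 0 \<le> a \<and> a \<le> b"
  shows "has_bochner_integral N (\<lambda>\<omega>. step_integral Y xs \<omega> * step_integral Y ys \<omega>)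
           (increment_form xs ys)"
  using xs
proof (induction xs)
  case Nil
  show ?case by (simp add: step_integral_def increment_form_def has_bochner_integral_zero)
next
  case (Cons x xs)
  obtain c a b where x: "x = (c, a, b)" by (cases x)
  have ab: "0 \<le> a" "0 \<le> b" using Cons.prems by (auto simp: x)
  have row: "has_bochner_integral N (\<lambda>\<omega>. c * (Y b \<omega> - Y a \<omega>) * step_integral Y ys \<omega>)
      (\<Sum>(d, p, q)\<leftarrow>ys. c * d * ((\<bar>b - p\<bar> + \<bar>a - q\<bar> - \<bar>b - q\<bar> - \<bar>a - p\<bar>) / 2))"
    using ys
  proof (induction ys)
    case Nil
    show ?case by (simp add: step_integral_def has_bochner_integral_zero)
  next
    case (Cons y ys)
    obtain d p q where y: "y = (d, p, q)" by (cases y)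
    have pq: "0 \<le> p" "0 \<le> q" using Cons.prems by (auto simp: y)
    have "has_bochner_integral N (\<lambda>\<omega>. (c * d) * ((Y b \<omega> - Y a \<omega>) * (Y q \<omega> - Y p \<omega>)))
        (c * d * ((\<bar>b - p\<bar> + \<bar>a - q\<bar> - \<bar>b - q\<bar> - \<bar>a - p\<bar>) / 2))"
      by (intro has_bochner_integral_mult_right has_bochner_integral_increment_product Y ab pq)
    from has_bochner_integral_add[OF this Cons.IH] Cons.prems show ?case
      by (simp add: y step_integral_def algebra_simps)
  qed
  from has_bochner_integral_add[OF row Cons.IH] Cons.prems show ?case
    by (simp add: x step_integral_def increment_form_def algebra_simps)
qed

lemma nn_integral_step_integral_square:
  fixes Y :: "real \<Rightarrow> 'b \<Rightarrow> real"
  assumes Y: "\<And>s t. 0 \<le> s \<Longrightarrow> 0 \<le> t \<Longrightarrow>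
      has_bochner_integral N (\<lambda>\<omega>. (Y t \<omega> - Y s \<omega>)\<^sup>2) \<bar>t - s\<bar>"
    and xs: "\<forall>(c, a, b)\<in>set xs. 0 \<le> a \<and> a \<le> b"
  shows "(\<integral>\<^sup>+\<omega>. ennreal ((step_integral Y xs \<omega>)\<^sup>2) \<partial>N) = ennreal (increment_form xs xs)"
  using has_bochner_integral_step_integral_product[OF Y xs xs]
  by (auto simp: has_bochner_integral_iff power2_eq_square nn_integral_eq_integral)

lemma has_bochner_integral_indicator_increment:
  assumes "0 \<le> s" "0 \<le> (t::real)"
  shows "has_bochner_integral lborel
    (\<lambda>u. (indicator {0<..t} u - indicator {0<..s} u :: real)\<^sup>2) \<bar>t - s\<bar>"
proof -
  have "has_bochner_integral lborel (indicator {min s t<..max s t} :: real \<Rightarrow> real) \<bar>t - s\<bar>"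
    using has_bochner_integral_real_indicator[of "{min s t<..max s t}" lborel]
    by (simp add: abs_if min_def max_def split: if_splits)
  then show ?thesis
    by (rule has_bochner_integral_cong[THEN iffD1, rotated -1])
       (use assms in \<open>auto simp: indicator_def min_def max_def\<close>)
qed

text \<open>The indicators \<open>1\<^bsub>(0, t]\<^esub>\<close> form a process on the half-line that has the same second moments of
  increments as Brownian motion, and integrating against it does nothing.\<close>

lemma step_fun_eq_step_integral:
  assumes "\<forall>(c, a, b)\<in>set xs. 0 \<le> a \<and> a \<le> b"
  shows "step_fun xs u = step_integral (\<lambda>t. indicator {0<..t}) xs u"
  using assms
  by (induction xs) (auto simp: step_fun_def step_integral_def indicator_def)

lemma (in standard_brownian_motion) has_bochner_integral_increment:
  assumes "0 \<le> s" "0 \<le> t"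
  shows "has_bochner_integral M (\<lambda>\<omega>. (B t \<omega> - B s \<omega>)\<^sup>2) \<bar>t - s\<bar>"
proof -
  have less: "has_bochner_integral M (\<lambda>\<omega>. (B t \<omega> - B s \<omega>)\<^sup>2) (t - s)" if "0 \<le> s" "s < t" for s t
  proof -
    note D = normal_increments[OF that]
    have "has_bochner_integral lborel (\<lambda>x. normal_density 0 (sqrt (t - s)) x * x\<^sup>2) (t - s)"
      using normal_moment_even[of "sqrt (t - s)" 0 1] that
      by (simp add: fact_numeral diff_divide_distrib)
    then show ?thesis
      using distributed_integrable[OF D, of "\<lambda>x. x\<^sup>2"] distributed_integral[OF D, of "\<lambda>x. x\<^sup>2"]
      by (simp add: has_bochner_integral_iff)
  qed
  consider "s < t" | "s = t" | "t < s" by linarith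
  then show ?thesis
    by cases (use less[of s t] less[of t s] assms in
      \<open>auto simp: has_bochner_integral_zero power2_commute\<close>)
qed

text \<open>Both sides are the same quadratic form in the list, since each process has increments of squared
  norm \<open>\<bar>t - s\<bar>\<close>.\<close>

lemma (in standard_brownian_motion) step_isometry:
  assumes "\<forall>(c, a, b)\<in>set xs. 0 \<le> a \<and> a \<le> b"
  shows "(\<integral>\<^sup>+\<omega>. ennreal ((step_integral B xs \<omega>)\<^sup>2) \<partial>M) =
         (\<integral>\<^sup>+u. ennreal ((step_fun xs u)\<^sup>2) \<partial>lborel)"
proof -
  have "(\<integral>\<^sup>+u. ennreal ((step_fun xs u)\<^sup>2) \<partial>lborel) = ennreal (increment_form xs xs)"
    using nn_integral_step_integral_square[of lborel "\<lambda>t. indicator {0<..t}",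
        OF has_bochner_integral_indicator_increment assms]
    by (simp add: step_fun_eq_step_integral[OF assms])
  then show ?thesis
    using nn_integral_step_integral_square[OF has_bochner_integral_increment assms] by simp
qed

section \<open>Mean-square limits\<close>

text \<open>A weighted replacement for the triangle inequality in \<open>L\<^sup>2\<close>: it avoids square roots of extended
  nonnegative integrals, and letting \<open>e\<close> tend to \<open>0\<close> recovers the sharp constant \<open>1\<close>.\<close>

lemma square_le_weighted_squares:
  fixes a b e :: real
  assumes "e > 0"
  shows "a\<^sup>2 \<le> (1 + e) * b\<^sup>2 + (1 + 1 / e) * (b - a)\<^sup>2"
proof -
  have "0 \<le> (e * b + (b - a))\<^sup>2 / e" using assms by simp
  also have "\<dots> = (1 + e) * b\<^sup>2 + (1 + 1 / e) * (b - a)\<^sup>2 - a\<^sup>2"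
    using assms by (simp add: power2_eq_square field_simps)
  finally show ?thesis by simp
qed

lemma nn_integral_square_le_weighted:
  fixes F G :: "'b \<Rightarrow> real"
  assumes [measurable]: "F \<in> borel_measurable N" "G \<in> borel_measurable N" and e: "e > 0"
  shows "(\<integral>\<^sup>+x. ennreal ((F x)\<^sup>2) \<partial>N) \<le>
    ennreal (1 + e) * (\<integral>\<^sup>+x. ennreal ((G x)\<^sup>2) \<partial>N) +
    ennreal (1 + 1 / e) * (\<integral>\<^sup>+x. ennreal ((G x - F x)\<^sup>2) \<partial>N)"
proof -
  have "(\<integral>\<^sup>+x. ennreal ((F x)\<^sup>2) \<partial>N) \<le>
     (\<integral>\<^sup>+x. ennreal (1 + e) * ennreal ((G x)\<^sup>2) + ennreal (1 + 1 / e) * ennreal ((G x - F x)\<^sup>2) \<partial>N)"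
    using e square_le_weighted_squares[OF e]
    by (intro nn_integral_mono) (simp flip: ennreal_mult ennreal_plus)
  also have "\<dots> = ennreal (1 + e) * (\<integral>\<^sup>+x. ennreal ((G x)\<^sup>2) \<partial>N) +
    ennreal (1 + 1 / e) * (\<integral>\<^sup>+x. ennreal ((G x - F x)\<^sup>2) \<partial>N)"
    by (simp add: nn_integral_add nn_integral_cmult)
  finally show ?thesis .
qed

text \<open>Equality of norms survives mean-square limits in two unrelated \<open>L\<^sup>2\<close> spaces. One inequality is
  enough, as the hypotheses are symmetric in the two sequences: compare \<open>F'\<close> with \<open>F n\<close>, then
  \<open>G n\<close> with \<open>G'\<close>, and let first \<open>n\<close> tend to infinity and then \<open>e\<close> to \<open>0\<close>.\<close>

lemma L2_limit_norm_le:
  fixes F :: "nat \<Rightarrow> 'a \<Rightarrow> real" and G :: "nat \<Rightarrow> 'b \<Rightarrow> real"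
  assumes [measurable]: "\<And>n. F n \<in> borel_measurable M" "F' \<in> borel_measurable M"
    "\<And>n. G n \<in> borel_measurable N" "G' \<in> borel_measurable N"
    and eq: "\<And>n. (\<integral>\<^sup>+x. ennreal ((F n x)\<^sup>2) \<partial>M) = (\<integral>\<^sup>+x. ennreal ((G n x)\<^sup>2) \<partial>N)"
    and F: "(\<lambda>n. \<integral>\<^sup>+x. ennreal ((F n x - F' x)\<^sup>2) \<partial>M) \<longlonglongrightarrow> 0"
    and G: "(\<lambda>n. \<integral>\<^sup>+x. ennreal ((G n x - G' x)\<^sup>2) \<partial>N) \<longlonglongrightarrow> 0"
  shows "(\<integral>\<^sup>+x. ennreal ((F' x)\<^sup>2) \<partial>M) \<le> (\<integral>\<^sup>+x. ennreal ((G' x)\<^sup>2) \<partial>N)" (is "?A \<le> ?C")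
proof (cases "?C = \<infinity>")
  case False
  then obtain c where c: "?C = ennreal c" "c \<ge> 0" by (cases ?C) auto
  have bound: "?A \<le> ennreal ((1 + e)\<^sup>2 * c)" if e: "e > 0" for e :: real
  proof -
    let ?k = "ennreal (1 + 1 / e)" and ?d = "ennreal (1 + e)"
    have "?A \<le> ?d * (?d * ?C + ?k * (\<integral>\<^sup>+x. ennreal ((G n x - G' x)\<^sup>2) \<partial>N)) +
          ?k * (\<integral>\<^sup>+x. ennreal ((F n x - F' x)\<^sup>2) \<partial>M)" for n
    proof -
      have "?A \<le> ?d * (\<integral>\<^sup>+x. ennreal ((G n x)\<^sup>2) \<partial>N) + ?k * (\<integral>\<^sup>+x. ennreal ((F n x - F' x)\<^sup>2) \<partial>M)"
        using nn_integral_square_le_weighted[of F' M "F n" e] e by (simp add: eq)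
      also have "(\<integral>\<^sup>+x. ennreal ((G n x)\<^sup>2) \<partial>N) \<le> ?d * ?C + ?k * (\<integral>\<^sup>+x. ennreal ((G n x - G' x)\<^sup>2) \<partial>N)"
        using nn_integral_square_le_weighted[of "G n" N G' e] e by (simp add: power2_commute)
      finally show ?thesis by (simp add: add_mono mult_left_mono)
    qed
    moreover have "(\<lambda>n. ?d * (?d * ?C + ?k * (\<integral>\<^sup>+x. ennreal ((G n x - G' x)\<^sup>2) \<partial>N)) +
          ?k * (\<integral>\<^sup>+x. ennreal ((F n x - F' x)\<^sup>2) \<partial>M)) \<longlonglongrightarrow> ?d * (?d * ?C + ?k * 0) + ?k * 0"
      by (intro tendsto_add ennreal_tendsto_cmult tendsto_const F G) auto
    ultimately have "?A \<le> ?d * (?d * ?C + ?k * 0) + ?k * 0"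
      by (intro LIMSEQ_le_const) auto
    also have "\<dots> = ennreal ((1 + e)\<^sup>2 * c)"
      using e c by (simp add: power2_eq_square mult.assoc del: ennreal_plus flip: ennreal_mult)
    finally show ?thesis .
  qed
  have "?A \<noteq> \<infinity>" using bound[of 1] by (auto simp: top_unique)
  then obtain a where a: "?A = ennreal a" "a \<ge> 0" by (cases ?A) auto
  have "((\<lambda>e. (1 + e)\<^sup>2 * c) \<longlongrightarrow> (1 + 0)\<^sup>2 * c) (at_right 0)"
    by (intro tendsto_intros)
  moreover have "eventually (\<lambda>e. a \<le> (1 + e)\<^sup>2 * c) (at_right 0)"
    using bound a c by (intro eventually_at_right_less[THEN eventually_mono]) (simp add: ennreal_le_iff)
  ultimately have "a \<le> (1 + 0)\<^sup>2 * c"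
    by (intro tendsto_lowerbound) auto
  then show ?thesis using a c by (simp add: ennreal_leI)
qed simp

lemma L2_diff_tendsto:
  fixes F G :: "nat \<Rightarrow> 'b \<Rightarrow> real"
  assumes [measurable]: "\<And>n. F n \<in> borel_measurable M" "F' \<in> borel_measurable M"
    "\<And>n. G n \<in> borel_measurable M" "G' \<in> borel_measurable M"
    and F: "(\<lambda>n. \<integral>\<^sup>+x. ennreal ((F n x - F' x)\<^sup>2) \<partial>M) \<longlonglongrightarrow> 0"
    and G: "(\<lambda>n. \<integral>\<^sup>+x. ennreal ((G n x - G' x)\<^sup>2) \<partial>M) \<longlonglongrightarrow> 0"
  shows "(\<lambda>n. \<integral>\<^sup>+x. ennreal (((F n x - G n x) - (F' x - G' x))\<^sup>2) \<partial>M) \<longlonglongrightarrow> 0"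
proof (rule tendsto_sandwich[OF _ _ tendsto_const])
  show "(\<lambda>n. 2 * (\<integral>\<^sup>+x. ennreal ((F n x - F' x)\<^sup>2) \<partial>M) + 2 * (\<integral>\<^sup>+x. ennreal ((G n x - G' x)\<^sup>2) \<partial>M))
    \<longlonglongrightarrow> 0"
    using tendsto_add[OF ennreal_tendsto_cmult[OF _ F, of 2] ennreal_tendsto_cmult[OF _ G, of 2]]
    by simp
  have "(\<integral>\<^sup>+x. ennreal (((F n x - G n x) - (F' x - G' x))\<^sup>2) \<partial>M) \<le>
     2 * (\<integral>\<^sup>+x. ennreal ((F n x - F' x)\<^sup>2) \<partial>M) + 2 * (\<integral>\<^sup>+x. ennreal ((G n x - G' x)\<^sup>2) \<partial>M)" for n
    using nn_integral_square_le_weighted[of "\<lambda>x. (F n x - G n x) - (F' x - G' x)" M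
        "\<lambda>x. F n x - F' x" 1] by simp
  then show "\<forall>\<^sub>F n in sequentially. (\<integral>\<^sup>+x. ennreal (((F n x - G n x) - (F' x - G' x))\<^sup>2) \<partial>M) \<le>
     2 * (\<integral>\<^sup>+x. ennreal ((F n x - F' x)\<^sup>2) \<partial>M) + 2 * (\<integral>\<^sup>+x. ennreal ((G n x - G' x)\<^sup>2) \<partial>M)"
    by simp
qed auto

section \<open>The Wiener isometry for differences\<close>

text \<open>As intervals in a list may overlap, the difference of two step functions is again given by a list:
  concatenate and negate coefficients. This lets the isometry for one step function act on the
  difference of two.\<close>

lemma step_integral_append_neg:
  "step_integral Y (xs @ map (\<lambda>(c, a, b). (- c, a, b)) ys) \<omega> =
   step_integral Y xs \<omega> - step_integral Y ys \<omega>"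
  by (induction ys) (auto simp: step_integral_def)

lemma step_fun_append_neg:
  "step_fun (xs @ map (\<lambda>(c, a, b). (- c, a, b)) ys) u = step_fun xs u - step_fun ys u"
  by (induction ys) (auto simp: step_fun_def)

lemma step_fun_eq_0:
  assumes "\<forall>(c, a, b)\<in>set xs. 0 \<le> a \<and> a \<le> b \<and> b \<le> t" "u \<notin> {0..t}"
  shows "step_fun xs u = 0"
  using assms by (induction xs) (auto simp: step_fun_def)

lemma borel_measurable_step_fun [measurable]: "step_fun xs \<in> borel_measurable borel"
  by (induction xs) (auto simp: step_fun_def[abs_def])

lemma (in standard_brownian_motion) borel_measurable_step_integral:
  assumes "\<forall>(c, a, b)\<in>set xs. 0 \<le> a \<and> a \<le> b"
  shows "step_integral B xs \<in> borel_measurable M"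
  using assms
proof (induction xs)
  case (Cons x xs)
  obtain c a b where x: "x = (c, a, b)" by (cases x)
  have [measurable]: "B a \<in> borel_measurable M" "B b \<in> borel_measurable M"
    using Cons.prems random_variable_B[of a] random_variable_B[of b] by (auto simp: x)
  have [measurable]: "step_integral B xs \<in> borel_measurable M" using Cons by auto
  have "step_integral B (x # xs) = (\<lambda>\<omega>. c * (B b \<omega> - B a \<omega>) + step_integral B xs \<omega>)"
    by (auto simp: x step_integral_def)
  then show ?case by simp
qed (simp add: step_integral_def[abs_def])

text \<open>Step functions with intervals inside \<open>[0, t]\<close> vanish outside, so convergence on \<open>[0, t]\<close> is
  convergence on the whole line to the extension of \<open>f\<close> by zero. Integrals over different time
  horizons then live in one common space.\<close>

lemma has_wiener_integral_approx:
  assumes "has_wiener_integral M B t f I"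
  shows "\<exists>\<xi>. (\<forall>n. \<forall>(c, a, b)\<in>set (\<xi> n). 0 \<le> a \<and> a \<le> b) \<and>
    ((\<lambda>n. \<integral>\<^sup>+u. ennreal ((step_fun (\<xi> n) u - indicator {0..t} u * f u)\<^sup>2) \<partial>lborel) \<longlonglongrightarrow> 0) \<and>
    ((\<lambda>n. \<integral>\<^sup>+\<omega>. ennreal ((step_integral B (\<xi> n) \<omega> - I \<omega>)\<^sup>2) \<partial>M) \<longlonglongrightarrow> 0)"
proof -
  obtain \<xi> where \<xi>: "\<And>n. \<forall>(c, a, b)\<in>set (\<xi> n). 0 \<le> a \<and> a \<le> b \<and> b \<le> t"
    and f: "(\<lambda>n. \<integral>\<^sup>+s\<in>{0..t}. ennreal ((step_fun (\<xi> n) s - f s)\<^sup>2) \<partial>lborel) \<longlonglongrightarrow> 0"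
    and I: "(\<lambda>n. \<integral>\<^sup>+\<omega>. ennreal ((step_integral B (\<xi> n) \<omega> - I \<omega>)\<^sup>2) \<partial>M) \<longlonglongrightarrow> 0"
    using assms unfolding has_wiener_integral_def by blast
  have "ennreal ((step_fun (\<xi> n) u - f u)\<^sup>2) * indicator {0..t} u =
      ennreal ((step_fun (\<xi> n) u - indicator {0..t} u * f u)\<^sup>2)" for n u
    using step_fun_eq_0[OF \<xi>, of u n] by (cases "u \<in> {0..t}") auto
  with f have "(\<lambda>n. \<integral>\<^sup>+u. ennreal ((step_fun (\<xi> n) u - indicator {0..t} u * f u)\<^sup>2) \<partial>lborel) \<longlonglongrightarrow> 0"
    by simp
  moreover have "\<forall>(c, a, b)\<in>set (\<xi> n). 0 \<le> a \<and> a \<le> b" for n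
    using \<xi>[of n] by auto
  ultimately show ?thesis using I by blast
qed

lemma (in standard_brownian_motion) wiener_isometry_diff:
  assumes I: "has_wiener_integral M B s f I" and J: "has_wiener_integral M B t g J"
  shows "(\<integral>\<^sup>+\<omega>. ennreal ((J \<omega> - I \<omega>)\<^sup>2) \<partial>M) =
    (\<integral>\<^sup>+u. ennreal ((indicator {0..t} u * g u - indicator {0..s} u * f u)\<^sup>2) \<partial>lborel)"
proof -
  have [measurable]: "I \<in> borel_measurable M" "J \<in> borel_measurable M"
      "(\<lambda>u. indicator {0..s} u * f u) \<in> borel_measurable lborel"
      "(\<lambda>u. indicator {0..t} u * g u) \<in> borel_measurable lborel"
    using I J by (auto simp: has_wiener_integral_def set_borel_measurable_def)
  obtain \<xi> where \<xi>: "\<And>n. \<forall>(c, a, b)\<in>set (\<xi> n). 0 \<le> a \<and> a \<le> b"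
    and \<xi>f: "(\<lambda>n. \<integral>\<^sup>+u. ennreal ((step_fun (\<xi> n) u - indicator {0..s} u * f u)\<^sup>2) \<partial>lborel) \<longlonglongrightarrow> 0"
    and \<xi>I: "(\<lambda>n. \<integral>\<^sup>+\<omega>. ennreal ((step_integral B (\<xi> n) \<omega> - I \<omega>)\<^sup>2) \<partial>M) \<longlonglongrightarrow> 0"
    using has_wiener_integral_approx[OF I] by blast
  obtain \<eta> where \<eta>: "\<And>n. \<forall>(c, a, b)\<in>set (\<eta> n). 0 \<le> a \<and> a \<le> b"
    and \<eta>g: "(\<lambda>n. \<integral>\<^sup>+u. ennreal ((step_fun (\<eta> n) u - indicator {0..t} u * g u)\<^sup>2) \<partial>lborel) \<longlonglongrightarrow> 0"
    and \<eta>J: "(\<lambda>n. \<integral>\<^sup>+\<omega>. ennreal ((step_integral B (\<eta> n) \<omega> - J \<omega>)\<^sup>2) \<partial>M) \<longlonglongrightarrow> 0"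
    using has_wiener_integral_approx[OF J] by blast
  have [measurable]: "step_integral B (\<xi> n) \<in> borel_measurable M"
    "step_integral B (\<eta> n) \<in> borel_measurable M" for n
    by (rule borel_measurable_step_integral[OF \<xi>], rule borel_measurable_step_integral[OF \<eta>])
  let ?\<zeta> = "\<lambda>n. \<eta> n @ map (\<lambda>(c, a, b). (- c, a, b)) (\<xi> n)"
  have "\<forall>(c, a, b)\<in>set (?\<zeta> n). 0 \<le> a \<and> a \<le> b" for n
    using \<xi>[of n] \<eta>[of n] by auto
  from step_isometry[OF this, unfolded step_integral_append_neg step_fun_append_neg]
  have eq: "(\<integral>\<^sup>+\<omega>. ennreal ((step_integral B (\<eta> n) \<omega> - step_integral B (\<xi> n) \<omega>)\<^sup>2) \<partial>M) =
      (\<integral>\<^sup>+u. ennreal ((step_fun (\<eta> n) u - step_fun (\<xi> n) u)\<^sup>2) \<partial>lborel)" for n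
    .
  note limM = L2_diff_tendsto[OF _ _ _ _ \<eta>J \<xi>I]
  note limN = L2_diff_tendsto[OF _ _ _ _ \<eta>g \<xi>f]
  show ?thesis
  proof (rule antisym)
    show "(\<integral>\<^sup>+\<omega>. ennreal ((J \<omega> - I \<omega>)\<^sup>2) \<partial>M) \<le>
      (\<integral>\<^sup>+u. ennreal ((indicator {0..t} u * g u - indicator {0..s} u * f u)\<^sup>2) \<partial>lborel)"
      by (rule L2_limit_norm_le[OF _ _ _ _ eq limM limN]) measurable
    show "(\<integral>\<^sup>+u. ennreal ((indicator {0..t} u * g u - indicator {0..s} u * f u)\<^sup>2) \<partial>lborel) \<le>
      (\<integral>\<^sup>+\<omega>. ennreal ((J \<omega> - I \<omega>)\<^sup>2) \<partial>M)"
      by (rule L2_limit_norm_le[OF _ _ _ _ eq[symmetric] limN limM]) measurable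
  qed
qed

text \<open>The integrand is within finite distance of a step function, which is square integrable. For the
  Hadamard kernel this replaces the evaluation of a Gamma integral.\<close>

lemma (in standard_brownian_motion) has_wiener_integral_square_integrable:
  assumes I: "has_wiener_integral M B t f I"
  shows "(\<integral>\<^sup>+u. ennreal ((indicator {0..t} u * f u)\<^sup>2) \<partial>lborel) < \<infinity>"
proof -
  have [measurable]: "(\<lambda>u. indicator {0..t} u * f u) \<in> borel_measurable lborel"
    using I by (auto simp: has_wiener_integral_def set_borel_measurable_def)
  obtain \<xi> where \<xi>: "\<And>n. \<forall>(c, a, b)\<in>set (\<xi> n). 0 \<le> a \<and> a \<le> b"
    and lim: "(\<lambda>n. \<integral>\<^sup>+u. ennreal ((step_fun (\<xi> n) u - indicator {0..t} u * f u)\<^sup>2) \<partial>lborel) \<longlonglongrightarrow> 0"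
    using has_wiener_integral_approx[OF I] by blast
  obtain n where n: "(\<integral>\<^sup>+u. ennreal ((step_fun (\<xi> n) u - indicator {0..t} u * f u)\<^sup>2) \<partial>lborel) < 1"
    using eventually_happens'[OF _ order_tendstoD(2)[OF lim, of 1]] by auto
  have "(\<integral>\<^sup>+u. ennreal ((step_fun (\<xi> n) u)\<^sup>2) \<partial>lborel) = ennreal (increment_form (\<xi> n) (\<xi> n))"
    by (rule trans[OF step_isometry[OF \<xi>, symmetric]
        nn_integral_step_integral_square[OF has_bochner_integral_increment \<xi>]])
  then have fin: "ennreal (1 + 1) * (\<integral>\<^sup>+u. ennreal ((step_fun (\<xi> n) u)\<^sup>2) \<partial>lborel) + ennreal (1 + 1 / 1) *
     (\<integral>\<^sup>+u. ennreal ((step_fun (\<xi> n) u - indicator {0..t} u * f u)\<^sup>2) \<partial>lborel) < \<infinity>"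
    using less_trans[OF n ennreal_one_less_top] by (simp add: ennreal_mult_less_top)
  show ?thesis
    by (rule le_less_trans[OF nn_integral_square_le_weighted fin]) simp_all
qed

section \<open>The Hadamard kernel\<close>

text \<open>The interval is open at both ends so that \<open>K\<^sub>s\<close> vanishes at \<open>s\<close> and the inequalities between
  kernels below hold at every point, with no exceptional endpoints.\<close>

definition hadamard_kernel :: "real \<Rightarrow> real \<Rightarrow> real \<Rightarrow> real" where
  "hadamard_kernel \<alpha> t u = indicator {0<..<t} u * ln (t / u) powr ((\<alpha> - 1) / 2)"

lemma borel_measurable_hadamard_kernel [measurable]: "hadamard_kernel \<alpha> t \<in> borel_measurable borel"
  unfolding hadamard_kernel_def[abs_def] by measurable

lemma hadamard_kernel_nonneg [simp]: "0 \<le> hadamard_kernel \<alpha> t u"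
  by (simp add: hadamard_kernel_def)

lemma hadamard_kernel_square:
  "(hadamard_kernel \<alpha> t u)\<^sup>2 = indicator {0<..<t} u * ln (t / u) powr (\<alpha> - 1)"
  by (auto simp: hadamard_kernel_def indicator_def powr_power diff_divide_distrib)

lemma AE_hadamard_kernel:
  "AE u in lborel. indicator {0..t} u * ln (t / u) powr ((\<alpha> - 1) / 2) = hadamard_kernel \<alpha> t u"
  using AE_lborel_singleton[of 0] AE_lborel_singleton[of t]
  by eventually_elim (auto simp: hadamard_kernel_def indicator_def)

text \<open>The kernel depends on \<open>u / t\<close> only, so the substitution \<open>u = t v\<close> applies.\<close>

lemma nn_integral_hadamard_kernel_square:
  assumes "t \<ge> 0"
  shows "(\<integral>\<^sup>+u. ennreal ((hadamard_kernel \<alpha> t u)\<^sup>2) \<partial>lborel) =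
    ennreal t * (\<integral>\<^sup>+u. ennreal ((hadamard_kernel \<alpha> 1 u)\<^sup>2) \<partial>lborel)"
proof (cases "t = 0")
  case False
  with assms have t: "t > 0" by simp
  have "hadamard_kernel \<alpha> t (0 + t * x) = hadamard_kernel \<alpha> 1 x" for x
    using t by (auto simp: hadamard_kernel_def indicator_def zero_less_mult_iff)
  with t show ?thesis
    by (subst nn_integral_real_affine[where t = 0 and c = t]) auto
qed (simp add: hadamard_kernel_def)

lemma hadamard_kernel_mono:
  assumes "\<alpha> \<ge> 1" "s \<le> t"
  shows "hadamard_kernel \<alpha> s u \<le> hadamard_kernel \<alpha> t u"
  using assms by (auto simp: hadamard_kernel_def indicator_def divide_right_mono intro!: powr_mono2)

lemma hadamard_kernel_antimono:
  assumes "\<alpha> \<le> 1" "s \<le> t" "u < s"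
  shows "hadamard_kernel \<alpha> t u \<le> hadamard_kernel \<alpha> s u"
  using assms by (auto simp: hadamard_kernel_def indicator_def divide_right_mono intro!: powr_mono2')

text \<open>This is \<open>ln x \<le> x - 1\<close> at \<open>x = u / t\<close>. It compares the logarithmic singularity of the kernel at
  \<open>u = t\<close> with a power of the distance.\<close>

lemma one_minus_inverse_le_ln:
  assumes "0 < u" "u < t"
  shows "(t - u) / t \<le> ln (t / (u::real))"
  using ln_le_minus_one[of "u / t"] assms by (simp add: ln_div field_simps)

lemma nn_integral_powr_left:
  fixes \<alpha> s t :: real
  assumes "\<alpha> > 0" "s \<le> t"
  shows "(\<integral>\<^sup>+u. ennreal (indicator {s..t} u * (t - u) powr (\<alpha> - 1)) \<partial>lborel) =
    ennreal ((t - s) powr \<alpha> / \<alpha>)"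
proof -
  have "((\<lambda>x. x powr (\<alpha> - 1)) has_integral (t - s) powr \<alpha> / \<alpha>) {0..t - s}"
    using has_integral_powr_from_0[of "\<alpha> - 1" "t - s"] assms by simp
  then have "(\<integral>\<^sup>+x. ennreal (indicator {0..t - s} x * x powr (\<alpha> - 1)) \<partial>lborel) =
      ennreal ((t - s) powr \<alpha> / \<alpha>)"
    by (rule nn_integral_has_integral_lebesgue[rotated]) simp
  moreover have "indicator {s..t} (t + - 1 * x) = (indicator {0..t - s} x :: real)" for x
    by (auto simp: indicator_def)
  ultimately show ?thesis
    by (subst nn_integral_real_affine[where t = t and c = "-1"]) auto
qed

lemma has_bochner_integral_powr_left:
  fixes \<alpha> s t :: real
  assumes "\<alpha> > 0" "s \<le> t"
  shows "has_bochner_integral lborel (\<lambda>u. indicator {s..t} u * (t - u) powr (\<alpha> - 1))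
    ((t - s) powr \<alpha> / \<alpha>)"
  using nn_integral_powr_left[OF assms] assms by (intro has_bochner_integral_nn_integral) auto

section \<open>Energy of an increment of the kernel\<close>

context
  fixes \<alpha> :: real
  assumes finite: "(\<integral>\<^sup>+u. ennreal ((hadamard_kernel \<alpha> 1 u)\<^sup>2) \<partial>lborel) < \<infinity>"
begin

lemma has_bochner_integral_hadamard_kernel_square:
  assumes "t \<ge> 0"
  shows "has_bochner_integral lborel (\<lambda>u. (hadamard_kernel \<alpha> t u)\<^sup>2)
    (t * (\<integral>u. (hadamard_kernel \<alpha> 1 u)\<^sup>2 \<partial>lborel))"
proof -
  have "integrable lborel (\<lambda>u. (hadamard_kernel \<alpha> 1 u)\<^sup>2)"
    using finite by (intro integrableI_bounded) auto
  then have "(\<integral>\<^sup>+u. ennreal ((hadamard_kernel \<alpha> t u)\<^sup>2) \<partial>lborel) =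
      ennreal (t * (\<integral>u. (hadamard_kernel \<alpha> 1 u)\<^sup>2 \<partial>lborel))"
    using nn_integral_hadamard_kernel_square[OF assms, of \<alpha>] assms
    by (simp add: nn_integral_eq_integral ennreal_mult)
  then show ?thesis
    using assms by (intro has_bochner_integral_nn_integral) auto
qed

lemma integrable_hadamard_kernel_square:
  assumes "t \<ge> 0"
  shows "integrable lborel (\<lambda>u. (hadamard_kernel \<alpha> t u)\<^sup>2)"
  using has_bochner_integral_hadamard_kernel_square[OF assms] by (simp add: has_bochner_integral_iff)

lemma integrable_hadamard_kernel_diff_square:
  assumes "s \<ge> 0" "t \<ge> 0"
  shows "integrable lborel (\<lambda>u. (hadamard_kernel \<alpha> t u - hadamard_kernel \<alpha> s u)\<^sup>2)"
proof (rule Bochner_Integration.integrable_bound)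
  show "integrable lborel (\<lambda>u. (hadamard_kernel \<alpha> t u)\<^sup>2 + (hadamard_kernel \<alpha> s u)\<^sup>2)"
    by (intro Bochner_Integration.integrable_add integrable_hadamard_kernel_square assms)
  show "AE u in lborel. norm ((hadamard_kernel \<alpha> t u - hadamard_kernel \<alpha> s u)\<^sup>2)
      \<le> norm ((hadamard_kernel \<alpha> t u)\<^sup>2 + (hadamard_kernel \<alpha> s u)\<^sup>2)"
  proof (rule AE_I2)
    fix u
    have "0 \<le> hadamard_kernel \<alpha> t u * hadamard_kernel \<alpha> s u" by simp
    then show "norm ((hadamard_kernel \<alpha> t u - hadamard_kernel \<alpha> s u)\<^sup>2)
      \<le> norm ((hadamard_kernel \<alpha> t u)\<^sup>2 + (hadamard_kernel \<alpha> s u)\<^sup>2)"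
      unfolding real_norm_def abs_of_nonneg[OF zero_le_power2]
      by (simp add: power2_diff mult.assoc)
  qed
qed auto

text \<open>If \<open>0 \<le> a \<le> b\<close>, then \<open>(b - a)\<^sup>2 \<le> b\<^sup>2 - a\<^sup>2\<close>. With the kernels increasing in time, the energy of the
  difference is at most the difference of the energies, which is linear in time.\<close>

lemma hadamard_energy_le_linear:
  assumes "\<alpha> \<ge> 1" "0 \<le> s" "s \<le> t"
  shows "(\<integral>u. (hadamard_kernel \<alpha> t u - hadamard_kernel \<alpha> s u)\<^sup>2 \<partial>lborel) \<le>
    (t - s) * (\<integral>u. (hadamard_kernel \<alpha> 1 u)\<^sup>2 \<partial>lborel)"
proof -
  have ge: "t \<ge> 0" using assms by simp
  note int = integrable_hadamard_kernel_square[OF ge] integrable_hadamard_kernel_square[OF assms(2)]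
  have "(\<integral>u. (hadamard_kernel \<alpha> t u - hadamard_kernel \<alpha> s u)\<^sup>2 \<partial>lborel) \<le>
    (\<integral>u. (hadamard_kernel \<alpha> t u)\<^sup>2 - (hadamard_kernel \<alpha> s u)\<^sup>2 \<partial>lborel)"
  proof (rule integral_mono)
    show "(hadamard_kernel \<alpha> t u - hadamard_kernel \<alpha> s u)\<^sup>2 \<le>
        (hadamard_kernel \<alpha> t u)\<^sup>2 - (hadamard_kernel \<alpha> s u)\<^sup>2" for u
      using mult_nonneg_nonneg[of "hadamard_kernel \<alpha> s u" "hadamard_kernel \<alpha> t u - hadamard_kernel \<alpha> s u"]
        hadamard_kernel_mono[OF assms(1,3), of u] by (simp add: power2_eq_square algebra_simps)
  qed (use assms ge int in \<open>auto intro: integrable_hadamard_kernel_diff_square\<close>)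
  also have "\<dots> = (t - s) * (\<integral>u. (hadamard_kernel \<alpha> 1 u)\<^sup>2 \<partial>lborel)"
    using has_bochner_integral_hadamard_kernel_square[OF ge]
      has_bochner_integral_hadamard_kernel_square[OF assms(2)] int
    by (simp add: has_bochner_integral_iff left_diff_distrib)
  finally show ?thesis .
qed

text \<open>The kernels now decrease in time on \<open>(0, s)\<close>, and the same elementary inequality bounds that part by
  \<open>K\<^sub>s\<^sup>2 - K\<^sub>t\<^sup>2\<close>. Adding \<open>2 K\<^sub>t\<^sup>2\<close> on \<open>[s, t)\<close> turns this into a majorant \<open>h\<close> on the whole line, where
  the total energies cancel up to the nonpositive amount \<open>c (s - t)\<close>. Only the tail
  over \<open>[s, t)\<close> is left, and it is of order \<open>(t - s)\<^sup>\<alpha>\<close>.\<close>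

lemma hadamard_energy_le_powr:
  assumes "0 < \<alpha>" "\<alpha> \<le> 1" "0 \<le> s" "s < t"
  shows "(\<integral>u. (hadamard_kernel \<alpha> t u - hadamard_kernel \<alpha> s u)\<^sup>2 \<partial>lborel) \<le>
    2 * t powr (1 - \<alpha>) * (t - s) powr \<alpha> / \<alpha>"
proof -
  let ?K = "hadamard_kernel \<alpha>"
  let ?p = "\<lambda>u. indicator {s..t} u * (t - u) powr (\<alpha> - 1)"
  let ?c = "\<integral>u. (?K 1 u)\<^sup>2 \<partial>lborel"
  have t: "t > 0" "t \<ge> 0" using assms by auto
  have "has_bochner_integral lborel
      (\<lambda>u. (?K s u)\<^sup>2 - (?K t u)\<^sup>2 + 2 * t powr (1 - \<alpha>) * ?p u)
      (s * ?c - t * ?c + 2 * t powr (1 - \<alpha>) * ((t - s) powr \<alpha> / \<alpha>))" (is "has_bochner_integral _ ?h ?i")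
    using assms t
    by (intro has_bochner_integral_add has_bochner_integral_diff has_bochner_integral_mult_right
        has_bochner_integral_powr_left has_bochner_integral_hadamard_kernel_square) auto
  then have h: "integrable lborel ?h" "integral\<^sup>L lborel ?h = ?i"
    by (auto simp: has_bochner_integral_iff)
  have "(\<integral>u. (?K t u - ?K s u)\<^sup>2 \<partial>lborel) \<le> integral\<^sup>L lborel ?h"
  proof (rule integral_mono[OF integrable_hadamard_kernel_diff_square h(1)])
    fix u
    show "(?K t u - ?K s u)\<^sup>2 \<le> ?h u"
    proof (cases "u < s")
      case True
      then have "0 \<le> ?K t u * (?K s u - ?K t u)"
        using hadamard_kernel_antimono[of \<alpha> s t u] assms by simp
      with True show ?thesis by (simp add: power2_eq_square algebra_simps)
    next
      case False
      then have Ks: "?K s u = 0" by (simp add: hadamard_kernel_def)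
      have "(?K t u)\<^sup>2 \<le> t powr (1 - \<alpha>) * ?p u"
      proof (cases "0 < u \<and> u < t")
        case True
        have "ln (t / u) powr (\<alpha> - 1) \<le> ((t - u) / t) powr (\<alpha> - 1)"
          using one_minus_inverse_le_ln[of u t] True assms by (intro powr_mono2') auto
        also have "\<dots> = t powr (1 - \<alpha>) * (t - u) powr (\<alpha> - 1)"
          using True t powr_minus[of t "\<alpha> - 1"] by (simp add: powr_divide field_simps)
        finally show ?thesis using True False by (simp add: hadamard_kernel_square)
      next
        case False
        then have "?K t u = 0" by (auto simp: hadamard_kernel_def)
        then show ?thesis by simp
      qed
      then show ?thesis by (simp add: Ks)
    qed
  qed (use assms in auto)
  also note h(2)
  also have "?i \<le> 2 * t powr (1 - \<alpha>) * ((t - s) powr \<alpha> / \<alpha>)"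
    using mult_right_mono[of s t ?c] assms by simp
  finally show ?thesis by simp
qed

text \<open>Beyond time \<open>s\<close> the kernel \<open>K\<^sub>s\<close> is zero, so there the energy density is \<open>K\<^sub>t\<^sup>2\<close>.\<close>

lemma hadamard_energy_ge_indicator:
  assumes "0 \<le> s" "s \<le> a" "a \<le> b" "b \<le> t"
    and le: "\<And>u. a < u \<Longrightarrow> u < b \<Longrightarrow> m \<le> ln (t / u) powr (\<alpha> - 1)"
  shows "m * (b - a) \<le> (\<integral>u. (hadamard_kernel \<alpha> t u - hadamard_kernel \<alpha> s u)\<^sup>2 \<partial>lborel)"
proof -
  have "m * indicator {a<..<b} u \<le> (hadamard_kernel \<alpha> t u - hadamard_kernel \<alpha> s u)\<^sup>2" for u
  proof (cases "u \<in> {a<..<b}")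
    case True
    then have "hadamard_kernel \<alpha> s u = 0" using assms by (simp add: hadamard_kernel_def)
    with True assms show ?thesis by (simp add: hadamard_kernel_square)
  qed simp
  then have "(\<integral>u. m * indicator {a<..<b} u \<partial>lborel) \<le>
      (\<integral>u. (hadamard_kernel \<alpha> t u - hadamard_kernel \<alpha> s u)\<^sup>2 \<partial>lborel)"
    using assms by (intro integral_mono integrable_hadamard_kernel_diff_square) auto
  then show ?thesis using assms by simp
qed

text \<open>On the upper half of \<open>(s, t)\<close> one has \<open>u > t / 2\<close>, hence \<open>0 < ln (t / u) \<le> t / u - 1 \<le> 1\<close>, and a
  nonpositive power of such a number is at least \<open>1\<close>.\<close>

lemma hadamard_energy_ge_linear:
  assumes "\<alpha> \<le> 1" "0 \<le> s" "s < t"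
  shows "(t - s) / 2 \<le> (\<integral>u. (hadamard_kernel \<alpha> t u - hadamard_kernel \<alpha> s u)\<^sup>2 \<partial>lborel)"
proof -
  have "1 * (t - (s + t) / 2) \<le> (\<integral>u. (hadamard_kernel \<alpha> t u - hadamard_kernel \<alpha> s u)\<^sup>2 \<partial>lborel)"
  proof (rule hadamard_energy_ge_indicator)
    fix u assume u: "(s + t) / 2 < u" "u < t"
    then have "t / u \<le> 2" "1 < t / u"
      using assms by (auto simp: field_simps)
    then have "ln (t / u) \<le> 1" "0 < ln (t / u)"
      using ln_le_minus_one[of "t / u"] by auto
    then have "1 powr (\<alpha> - 1) \<le> ln (t / u) powr (\<alpha> - 1)"
      using assms by (intro powr_mono2') auto
    then show "1 \<le> ln (t / u) powr (\<alpha> - 1)" by simp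
  qed (use assms in auto)
  then show ?thesis by (simp add: field_simps)
qed

text \<open>For \<open>\<alpha> > 1\<close> the power of the logarithm tends to \<open>0\<close> at \<open>t\<close>, so the lower half of \<open>(s, t)\<close> is used,
  where \<open>ln (t / u) \<ge> (t - u) / t \<ge> (t - s) / (2 t)\<close>.\<close>

lemma hadamard_energy_ge_powr:
  assumes "\<alpha> \<ge> 1" "0 \<le> s" "s < t"
  shows "t powr (1 - \<alpha>) * ((t - s) / 2) powr \<alpha> \<le>
    (\<integral>u. (hadamard_kernel \<alpha> t u - hadamard_kernel \<alpha> s u)\<^sup>2 \<partial>lborel)"
proof -
  define d where "d = (t - s) / 2"
  have "(d / t) powr (\<alpha> - 1) * ((s + t) / 2 - s) \<le>
      (\<integral>u. (hadamard_kernel \<alpha> t u - hadamard_kernel \<alpha> s u)\<^sup>2 \<partial>lborel)"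
  proof (rule hadamard_energy_ge_indicator)
    fix u assume u: "s < u" "u < (s + t) / 2"
    then have "d / t \<le> (t - u) / t" using assms by (intro divide_right_mono) (auto simp: d_def field_simps)
    also have "\<dots> \<le> ln (t / u)" using u assms by (intro one_minus_inverse_le_ln) auto
    finally show "(d / t) powr (\<alpha> - 1) \<le> ln (t / u) powr (\<alpha> - 1)"
      using assms by (intro powr_mono2) (auto simp: d_def)
  qed (use assms in auto)
  also have "(d / t) powr (\<alpha> - 1) * ((s + t) / 2 - s) = t powr (1 - \<alpha>) * d powr \<alpha>"
  proof -
    have "(d / t) powr (\<alpha> - 1) = d powr (\<alpha> - 1) / t powr (\<alpha> - 1)"
      by (rule powr_divide)
    moreover have "t powr (1 - \<alpha>) = 1 / t powr (\<alpha> - 1)"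
      using powr_minus_divide[of t "\<alpha> - 1"] by simp
    moreover have "d powr \<alpha> = d powr (\<alpha> - 1) * d"
      using powr_add[of d "\<alpha> - 1" 1] assms by (simp add: d_def)
    moreover have "(s + t) / 2 - s = d" by (simp add: d_def field_simps)
    ultimately show ?thesis by simp
  qed
  finally show ?thesis by (simp add: d_def)
qed

end

section \<open>Second moments of the increments\<close>

text \<open>The process is set to \<open>0\<close> at time \<open>0\<close> by definition. Seeing that value as a Wiener integral
  over \<open>[0, 0]\<close> means that \<open>s = 0\<close> needs no separate treatment below.\<close>

lemma has_wiener_integral_zero_time: "has_wiener_integral M B 0 f (\<lambda>_. 0)"
proof -
  have "(\<lambda>u. indicator {0..0} u *\<^sub>R f u) = (\<lambda>u::real. f 0 * indicator {0} u)"
    by (auto simp: indicator_def)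
  then have "set_borel_measurable lborel {0..0} f"
    by (simp add: set_borel_measurable_def)
  moreover have "(\<integral>\<^sup>+s\<in>{0..0}. ennreal ((step_fun [] s - f s)\<^sup>2) \<partial>lborel) = 0"
    by (rule nn_integral_null_set) (auto intro: finite_imp_null_set_lborel)
  ultimately show ?thesis
    unfolding has_wiener_integral_def
    by (intro conjI exI[of _ "\<lambda>_. []"]) (auto simp: step_integral_def)
qed

lemma hadamard_fbm_eq_wiener_integral:
  assumes "hadamard_fbm M B \<alpha> X" "t \<ge> 0"
  obtains I where "has_wiener_integral M B t (\<lambda>s. ln (t / s) powr ((\<alpha> - 1) / 2)) I"
    "\<forall>\<omega>\<in>space M. X t \<omega> = 1 / sqrt (Gamma \<alpha>) * I \<omega>"
proof (cases "t = 0")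
  case True
  from assms(1) have "\<forall>\<omega>\<in>space M. X t \<omega> = 1 / sqrt (Gamma \<alpha>) * 0"
    by (simp add: hadamard_fbm_def True)
  with has_wiener_integral_zero_time show thesis using that True by blast
next
  case False
  with assms have "\<exists>I. has_wiener_integral M B t (\<lambda>s. ln (t / s) powr ((\<alpha> - 1) / 2)) I \<and>
      (\<forall>\<omega>\<in>space M. X t \<omega> = 1 / sqrt (Gamma \<alpha>) * I \<omega>)"
    by (simp add: hadamard_fbm_def)
  with that show thesis by blast
qed

context standard_brownian_motion
begin

lemma hadamard_kernel_square_integrable:
  assumes "hadamard_fbm M B \<alpha> X"
  shows "(\<integral>\<^sup>+u. ennreal ((hadamard_kernel \<alpha> 1 u)\<^sup>2) \<partial>lborel) < \<infinity>"
proof -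
  obtain I where "has_wiener_integral M B 1 (\<lambda>s. ln (1 / s) powr ((\<alpha> - 1) / 2)) I"
    using hadamard_fbm_eq_wiener_integral[OF assms, of 1] by auto
  from has_wiener_integral_square_integrable[OF this]
  have fin: "(\<integral>\<^sup>+u. ennreal ((indicator {0..1} u * ln (1 / u) powr ((\<alpha> - 1) / 2))\<^sup>2) \<partial>lborel) < \<infinity>" .
  have "(\<integral>\<^sup>+u. ennreal ((hadamard_kernel \<alpha> 1 u)\<^sup>2) \<partial>lborel) =
      (\<integral>\<^sup>+u. ennreal ((indicator {0..1} u * ln (1 / u) powr ((\<alpha> - 1) / 2))\<^sup>2) \<partial>lborel)"
    using AE_hadamard_kernel[of 1 \<alpha>] by (intro nn_integral_cong_AE) (auto elim!: eventually_mono)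
  with fin show ?thesis by metis
qed

lemma has_bochner_integral_hadamard_increment:
  assumes X: "hadamard_fbm M B \<alpha> X" and \<alpha>: "\<alpha> > 0" and "0 \<le> s" "0 \<le> t"
  shows "has_bochner_integral M (\<lambda>\<omega>. \<bar>X t \<omega> - X s \<omega>\<bar>\<^sup>2)
    ((\<integral>u. (hadamard_kernel \<alpha> t u - hadamard_kernel \<alpha> s u)\<^sup>2 \<partial>lborel) / Gamma \<alpha>)"
proof -
  let ?k = "\<lambda>t u. ln (t / u) powr ((\<alpha> - 1) / 2)"
  let ?D = "\<integral>u. (hadamard_kernel \<alpha> t u - hadamard_kernel \<alpha> s u)\<^sup>2 \<partial>lborel"
  obtain I where I: "has_wiener_integral M B s (?k s) I"
    and XI: "\<forall>\<omega>\<in>space M. X s \<omega> = 1 / sqrt (Gamma \<alpha>) * I \<omega>"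
    by (rule hadamard_fbm_eq_wiener_integral[OF X \<open>0 \<le> s\<close>])
  obtain J where J: "has_wiener_integral M B t (?k t) J"
    and XJ: "\<forall>\<omega>\<in>space M. X t \<omega> = 1 / sqrt (Gamma \<alpha>) * J \<omega>"
    by (rule hadamard_fbm_eq_wiener_integral[OF X \<open>0 \<le> t\<close>])
  have [measurable]: "I \<in> borel_measurable M" "J \<in> borel_measurable M"
    using I J by (auto simp: has_wiener_integral_def)
  have "(\<integral>\<^sup>+\<omega>. ennreal ((J \<omega> - I \<omega>)\<^sup>2) \<partial>M) =
      (\<integral>\<^sup>+u. ennreal ((indicator {0..t} u * ?k t u - indicator {0..s} u * ?k s u)\<^sup>2) \<partial>lborel)"
    by (rule wiener_isometry_diff[OF I J])
  also have "\<dots> = (\<integral>\<^sup>+u. ennreal ((hadamard_kernel \<alpha> t u - hadamard_kernel \<alpha> s u)\<^sup>2) \<partial>lborel)"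
  proof (rule nn_integral_cong_AE)
    show "AE u in lborel.
        ennreal ((indicator {0..t} u * ?k t u - indicator {0..s} u * ?k s u)\<^sup>2) =
        ennreal ((hadamard_kernel \<alpha> t u - hadamard_kernel \<alpha> s u)\<^sup>2)"
      using AE_hadamard_kernel[of t \<alpha>] AE_hadamard_kernel[of s \<alpha>]
      by eventually_elim (simp only:)
  qed
  also have "\<dots> = ennreal ?D"
    using integrable_hadamard_kernel_diff_square[OF hadamard_kernel_square_integrable[OF X] assms(3,4)]
    by (simp add: nn_integral_eq_integral)
  finally have "has_bochner_integral M (\<lambda>\<omega>. (J \<omega> - I \<omega>)\<^sup>2) ?D"
    by (intro has_bochner_integral_nn_integral) auto
  from has_bochner_integral_divide[OF this, of "Gamma \<alpha>"]
  show ?thesis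
  proof (rule has_bochner_integral_cong[THEN iffD1, rotated -1])
    fix \<omega> assume \<omega>: "\<omega> \<in> space M"
    have "X t \<omega> - X s \<omega> = (J \<omega> - I \<omega>) / sqrt (Gamma \<alpha>)"
      using XI XJ \<omega> by (simp add: diff_divide_distrib)
    then show "(J \<omega> - I \<omega>)\<^sup>2 / Gamma \<alpha> = \<bar>X t \<omega> - X s \<omega>\<bar>\<^sup>2"
      using Gamma_real_pos[OF \<alpha>] by (simp add: power_divide)
  qed auto
qed

lemma borel_measurable_hadamard_fbm:
  assumes "hadamard_fbm M B \<alpha> X" "t \<ge> 0"
  shows "X t \<in> borel_measurable M"
proof -
  obtain I where I: "has_wiener_integral M B t (\<lambda>s. ln (t / s) powr ((\<alpha> - 1) / 2)) I"
    and XI: "\<forall>\<omega>\<in>space M. X t \<omega> = 1 / sqrt (Gamma \<alpha>) * I \<omega>"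
    by (rule hadamard_fbm_eq_wiener_integral[OF assms])
  have "(\<lambda>\<omega>. 1 / sqrt (Gamma \<alpha>) * I \<omega>) \<in> borel_measurable M"
    using I by (auto simp: has_wiener_integral_def)
  then show ?thesis
    using XI by (subst measurable_cong) auto
qed

text \<open>The factor \<open>1 / \<Gamma>(\<alpha>)\<close> is absorbed in the constants, and symmetry in \<open>s\<close> and \<open>t\<close> reduces the
  bounds to \<open>s < t\<close>.\<close>

lemma hadamard_fbm_quasi_helixI:
  assumes X: "hadamard_fbm M B \<alpha> X" and \<alpha>: "\<alpha> > 0"
    and pos: "\<gamma>1 > 0" "\<gamma>2 > 0" "c1 > 0" "c2 > 0"
    and bounds: "\<And>s t. 0 \<le> s \<Longrightarrow> s < t \<Longrightarrow> t \<le> T \<Longrightarrow>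
      c1 * (t - s) powr \<gamma>1 \<le> (\<integral>u. (hadamard_kernel \<alpha> t u - hadamard_kernel \<alpha> s u)\<^sup>2 \<partial>lborel) \<and>
      (\<integral>u. (hadamard_kernel \<alpha> t u - hadamard_kernel \<alpha> s u)\<^sup>2 \<partial>lborel) \<le> c2 * (t - s) powr \<gamma>2"
  shows "generalized_quasi_helix M X \<gamma>1 \<gamma>2 T"
proof -
  let ?D = "\<lambda>s t. \<integral>u. (hadamard_kernel \<alpha> t u - hadamard_kernel \<alpha> s u)\<^sup>2 \<partial>lborel"
  have G: "Gamma \<alpha> > 0" using \<alpha> by (rule Gamma_real_pos)
  have D: "c1 * \<bar>t - s\<bar> powr \<gamma>1 \<le> ?D s t \<and> ?D s t \<le> c2 * \<bar>t - s\<bar> powr \<gamma>2"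
    if "s \<in> {0..T}" "t \<in> {0..T}" for s t
  proof -
    have sym: "?D s t = ?D t s" by (intro Bochner_Integration.integral_cong refl power2_commute)
    consider "s < t" | "s = t" | "t < s" by linarith
    then show ?thesis
    proof cases
      case 1 then show ?thesis using bounds[of s t] that by simp
    next
      case 2 then show ?thesis by simp
    next
      case 3 then show ?thesis using bounds[of t s] that unfolding sym by simp
    qed
  qed
  have bound: "integrable M (\<lambda>\<omega>. \<bar>X t \<omega> - X s \<omega>\<bar>\<^sup>2) \<and>
      c1 / Gamma \<alpha> * \<bar>t - s\<bar> powr \<gamma>1 \<le> (\<integral>\<omega>. \<bar>X t \<omega> - X s \<omega>\<bar>\<^sup>2 \<partial>M) \<and>
      (\<integral>\<omega>. \<bar>X t \<omega> - X s \<omega>\<bar>\<^sup>2 \<partial>M) \<le> c2 / Gamma \<alpha> * \<bar>t - s\<bar> powr \<gamma>2"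
    if st: "s \<in> {0..T}" "t \<in> {0..T}" for s t
  proof -
    have "has_bochner_integral M (\<lambda>\<omega>. \<bar>X t \<omega> - X s \<omega>\<bar>\<^sup>2) (?D s t / Gamma \<alpha>)"
      using has_bochner_integral_hadamard_increment[OF X \<alpha>] st by simp
    then have "integrable M (\<lambda>\<omega>. \<bar>X t \<omega> - X s \<omega>\<bar>\<^sup>2)"
      and eq: "(\<integral>\<omega>. \<bar>X t \<omega> - X s \<omega>\<bar>\<^sup>2 \<partial>M) = ?D s t / Gamma \<alpha>"
      by (simp_all only: has_bochner_integral_iff)
    moreover have "c1 / Gamma \<alpha> * \<bar>t - s\<bar> powr \<gamma>1 \<le> ?D s t / Gamma \<alpha>"
      "?D s t / Gamma \<alpha> \<le> c2 / Gamma \<alpha> * \<bar>t - s\<bar> powr \<gamma>2"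
      using D[OF st] divide_right_mono[of _ _ "Gamma \<alpha>"] G unfolding times_divide_eq_left
      by (blast intro: less_imp_le)+
    ultimately show ?thesis unfolding eq by blast
  qed
  have c: "c1 / Gamma \<alpha> > 0" "c2 / Gamma \<alpha> > 0" using pos G by auto
  have "\<exists>C1>0. \<exists>C2>0. \<forall>s\<in>{0..T}. \<forall>t\<in>{0..T}.
      integrable M (\<lambda>\<omega>. \<bar>X t \<omega> - X s \<omega>\<bar>\<^sup>2) \<and>
      C1 * \<bar>t - s\<bar> powr \<gamma>1 \<le> (\<integral>\<omega>. \<bar>X t \<omega> - X s \<omega>\<bar>\<^sup>2 \<partial>M) \<and>
      (\<integral>\<omega>. \<bar>X t \<omega> - X s \<omega>\<bar>\<^sup>2 \<partial>M) \<le> C2 * \<bar>t - s\<bar> powr \<gamma>2"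
    by (rule exI[of _ "c1 / Gamma \<alpha>"], rule conjI, rule c(1),
        rule exI[of _ "c2 / Gamma \<alpha>"], rule conjI, rule c(2), intro ballI, rule bound)
  moreover have "\<forall>t\<in>{0..T}. X t \<in> borel_measurable M"
    using borel_measurable_hadamard_fbm[OF X] by simp
  ultimately show ?thesis
    unfolding generalized_quasi_helix_def using prob_space_axioms pos(1,2) by (intro conjI)
qed

end

theorem theorem4p1:
  fixes M :: "'a measure" and B X :: "real \<Rightarrow> 'a \<Rightarrow> real" and \<alpha> T :: real
  assumes "standard_brownian_motion M B"
    and "\<alpha> > 0"
    and "hadamard_fbm M B \<alpha> X"
    and "T > 0"
  shows "(\<alpha> \<in> {0<..<1} \<longrightarrow> generalized_quasi_helix M X 1 \<alpha> T) \<and>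
         (\<alpha> \<in> {1<..<2} \<longrightarrow> generalized_quasi_helix M X \<alpha> 1 T)"
proof (intro conjI impI)
  interpret standard_brownian_motion M B by fact
  note fin = hadamard_kernel_square_integrable[OF assms(3)]
  let ?D = "\<lambda>s t. \<integral>u. (hadamard_kernel \<alpha> t u - hadamard_kernel \<alpha> s u)\<^sup>2 \<partial>lborel"
  show "generalized_quasi_helix M X 1 \<alpha> T" if \<alpha>: "\<alpha> \<in> {0<..<1}"
  proof (rule hadamard_fbm_quasi_helixI[OF assms(3,2)])
    fix s t :: real assume st: "0 \<le> s" "s < t" "t \<le> T"
    \<comment> \<open>Here \<open>1 - \<alpha> > 0\<close>, so \<open>t\<close> may be enlarged to \<open>T\<close>.\<close>
    have "?D s t \<le> 2 * t powr (1 - \<alpha>) * (t - s) powr \<alpha> / \<alpha>"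
      using hadamard_energy_le_powr[OF fin] \<alpha> st by simp
    also have "\<dots> \<le> 2 * T powr (1 - \<alpha>) * (t - s) powr \<alpha> / \<alpha>"
      using \<alpha> st by (intro divide_right_mono mult_right_mono mult_left_mono powr_mono2) auto
    finally have "?D s t \<le> 2 * T powr (1 - \<alpha>) / \<alpha> * (t - s) powr \<alpha>" by simp
    then show "1 / 2 * (t - s) powr 1 \<le> ?D s t \<and> ?D s t \<le> 2 * T powr (1 - \<alpha>) / \<alpha> * (t - s) powr \<alpha>"
      using hadamard_energy_ge_linear[OF fin, of s t] \<alpha> st by simp
  qed (use assms in auto)
  show "generalized_quasi_helix M X \<alpha> 1 T" if \<alpha>: "\<alpha> \<in> {1<..<2}"
  proof (rule hadamard_fbm_quasi_helixI[OF assms(3,2)])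
    let ?c = "\<integral>u. (hadamard_kernel \<alpha> 1 u)\<^sup>2 \<partial>lborel"
    fix s t :: real assume st: "0 \<le> s" "s < t" "t \<le> T"
    \<comment> \<open>Here \<open>1 - \<alpha> < 0\<close>, so enlarging \<open>t\<close> to \<open>T\<close> lowers the bound.\<close>
    have "T powr (1 - \<alpha>) / 2 powr \<alpha> * (t - s) powr \<alpha> \<le> t powr (1 - \<alpha>) * ((t - s) / 2) powr \<alpha>"
      using \<alpha> st powr_mono2'[of "1 - \<alpha>" t T] by (simp add: powr_divide mult_right_mono divide_right_mono)
    also have "\<dots> \<le> ?D s t"
      using hadamard_energy_ge_powr[OF fin] \<alpha> st by simp
    finally have "T powr (1 - \<alpha>) / 2 powr \<alpha> * (t - s) powr \<alpha> \<le> ?D s t" .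
    \<comment> \<open>The summand \<open>1\<close> makes the constant positive without computing \<open>?c\<close>.\<close>
    moreover have "?D s t \<le> (?c + 1) * (t - s) powr 1"
      using hadamard_energy_le_linear[OF fin, of s t] \<alpha> st by (simp add: algebra_simps)
    ultimately show "T powr (1 - \<alpha>) / 2 powr \<alpha> * (t - s) powr \<alpha> \<le> ?D s t \<and>
        ?D s t \<le> (?c + 1) * (t - s) powr 1" by simp
  qed (use assms in \<open>auto intro: add_nonneg_pos\<close>)
qed

end
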